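(* Let $G$ be a nice graph with $\mathrm{mad}(G)\leq 3$. Then, for every set $W$ of $|E(G)|+6$ distinct strictly positive integers, there exists an edge-injective neighbour-sum-distinguishing $W$-edge-weighting of $G$. In particular, $\chi^{e,1}_\Sigma(G)\leq |E(G)|+6$.
   Context: All graphs are finite, simple, undirected and loopless. A graph is nice if none of its connected components is isomorphic to $K_2$. The maximum average degree is $\mathrm{mad}(G)=\max\{2|E(H)|/|V(H)| : H \text{ a non-empty subgraph of } G\}$. For a set $W$ of weights, a $W$-edge-weighting of $G$ is a map $w:E(G)\to W$; a $k$-edge-weighting is a $\{1,\dots,k\}$-edge-weighting. For a vertex $v$, $\sigma_w(v)=\sum_{u\in N(v)} w(vu)$. The weighting $w$ is neighbour-sum-distinguishing if $\sigma_w(u)\neq\sigma_w(v)$ for every edge $uv$, and edge-injective if no two distinct edges receive the same weight. For a nice graph $G$, $\chi^{e,1}_\Sigma(G)$ is the smallest $k$ such that $G$ admits an edge-injective neighbour-sum-distinguishing $k$-edge-weighting. *)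

theory Defs
  imports Complex_Main
begin

type_synonym 'a sgraph = "'a set \<times> 'a set set"

abbreviation verts :: "'a sgraph \<Rightarrow> 'a set" where
  "verts G \<equiv> fst G"

abbreviation edges :: "'a sgraph \<Rightarrow> 'a set set" where
  "edges G \<equiv> snd G"

definition simple_graph :: "'a sgraph \<Rightarrow> bool" where
  "simple_graph G \<longleftrightarrow> finite (verts G) \<and> (\<forall>e\<in>edges G. e \<subseteq> verts G \<and> card e = 2)"

definition adj :: "'a sgraph \<Rightarrow> 'a \<Rightarrow> 'a \<Rightarrow> bool" where
  "adj G u v \<longleftrightarrow> {u, v} \<in> edges G"

definition neighbours :: "'a sgraph \<Rightarrow> 'a \<Rightarrow> 'a set" where
  "neighbours G v = {u. adj G v u}"

definition subgraph :: "'a sgraph \<Rightarrow> 'a sgraph \<Rightarrow> bool" where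
  "subgraph H G \<longleftrightarrow> simple_graph H \<and> verts H \<subseteq> verts G \<and> edges H \<subseteq> edges G"

definition induced_subgraph :: "'a sgraph \<Rightarrow> 'a set \<Rightarrow> 'a sgraph" where
  "induced_subgraph G S = (S, {e \<in> edges G. e \<subseteq> S})"

definition components :: "'a sgraph \<Rightarrow> 'a sgraph set" where
  "components G = {induced_subgraph G {u. (adj G)\<^sup>*\<^sup>* v u} | v. v \<in> verts G}"

definition isomorphic :: "'a sgraph \<Rightarrow> 'b sgraph \<Rightarrow> bool" where
  "isomorphic G H \<longleftrightarrow> (\<exists>f. bij_betw f (verts G) (verts H) \<and>
     (\<forall>u\<in>verts G. \<forall>v\<in>verts G. adj G u v \<longleftrightarrow> adj H (f u) (f v)))"

definition complete_graph :: "nat \<Rightarrow> nat sgraph" where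
  "complete_graph n = ({..<n}, {e. e \<subseteq> {..<n} \<and> card e = 2})"

definition nice :: "'a sgraph \<Rightarrow> bool" where
  "nice G \<longleftrightarrow> (\<forall>H\<in>components G. \<not> isomorphic H (complete_graph 2))"

text \<open>The maximum is unspecified for the graph without vertices, which has no non-empty subgraph.\<close>

definition mad :: "'a sgraph \<Rightarrow> real" where
  "mad G = Max {2 * real (card (edges H)) / real (card (verts H)) | H. subgraph H G \<and> verts H \<noteq> {}}"

text \<open>A weighting is a total function on vertex sets; only its values on the edges matter.\<close>

definition edge_weighting :: "int set \<Rightarrow> 'a sgraph \<Rightarrow> ('a set \<Rightarrow> int) \<Rightarrow> bool" where
  "edge_weighting W G w \<longleftrightarrow> (\<forall>e\<in>edges G. w e \<in> W)"

definition weight_sum :: "'a sgraph \<Rightarrow> ('a set \<Rightarrow> int) \<Rightarrow> 'a \<Rightarrow> int" where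
  "weight_sum G w v = (\<Sum>u\<in>neighbours G v. w {v, u})"

definition neighbour_sum_distinguishing :: "'a sgraph \<Rightarrow> ('a set \<Rightarrow> int) \<Rightarrow> bool" where
  "neighbour_sum_distinguishing G w \<longleftrightarrow>
     (\<forall>u v. adj G u v \<longrightarrow> weight_sum G w u \<noteq> weight_sum G w v)"

definition edge_injective :: "'a sgraph \<Rightarrow> ('a set \<Rightarrow> int) \<Rightarrow> bool" where
  "edge_injective G w \<longleftrightarrow> inj_on w (edges G)"

definition chi_e1_sum :: "'a sgraph \<Rightarrow> nat" where
  "chi_e1_sum G = (LEAST k. \<exists>w. edge_weighting {1..int k} G w \<and>
     edge_injective G w \<and> neighbour_sum_distinguishing G w)"

lemma finite_subgraphs:
  assumes "simple_graph G"
  shows "finite {H. subgraph H G}"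
proof (rule finite_subset)
  show "{H. subgraph H G} \<subseteq> Pow (verts G) \<times> Pow (edges G)"
    by (auto simp: subgraph_def)
  have "edges G \<subseteq> Pow (verts G)"
    using assms by (auto simp: simple_graph_def)
  then show "finite (Pow (verts G) \<times> Pow (edges G))"
    using assms by (auto simp: simple_graph_def intro: finite_subset)
qed

end

theory Submission
  imports Defs
begin

text \<open>
  Since weights are positive, an edge with a leaf at exactly one end is distinguished automatically.
  Hence it suffices to distinguish the edges both of whose ends have degree at least 2, a
  requirement that makes sense for graphs with \<open>K\<^sub>2\<close> components too, so that arbitrary edges may
  be deleted in an induction on the number of edges. Deleting \<open>n\<close> edges leaves \<open>n + 6\<close> unused weights
  to put them back.

  Three configurations are reducible: a leaf whose neighbour has at most six non-leaf neighbours;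
  a path \<open>xvy\<close> with \<open>d(x) \<le> 7\<close> and \<open>d(y) + d(v) \<le> 8\<close>; and a vertex \<open>u\<close> with \<open>n \<ge> 3\<close> neighbours of
  degree at most 2, \<open>k\<close> of them leaves, and at most \<open>k + 3\<close> other neighbours. In the last case the
  \<open>n\<close> largest weights are withheld from the smaller graph and two of them are used at \<open>u\<close>, so the sum
  at \<open>u\<close> exceeds the sum at its neighbours of degree 2; the other neighbours exclude fewer values
  than there are subset sums of the remaining weights.

  If none of these occurs, let every vertex have charge \<open>d(v) - 3\<close> and let each vertex of degree at
  least 7 send \<open>3 - d(x)\<close> to every neighbour \<open>x\<close> with \<open>d(x) \<le> 2\<close>. All charges become nonnegative, and
  positive at vertices of degree at least 4, so \<open>mad(G) \<le> 3\<close> forces the graph to be cubic,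
  where the second configuration occurs.
\<close>

section \<open>Edge sets, degrees and weight sums\<close>

text \<open>A graph is represented by its edge set alone: isolated vertices carry no condition, and
  deleting edges becomes set difference.\<close>

definition uniform2 :: "'a set set \<Rightarrow> bool" where
  "uniform2 E \<longleftrightarrow> finite E \<and> (\<forall>e\<in>E. card e = 2)"

definition inc :: "'a set set \<Rightarrow> 'a \<Rightarrow> 'a set set" where
  "inc E v = {e \<in> E. v \<in> e}"

definition deg :: "'a set set \<Rightarrow> 'a \<Rightarrow> nat" where
  "deg E v = card (inc E v)"

definition nbrs :: "'a set set \<Rightarrow> 'a \<Rightarrow> 'a set" where
  "nbrs E v = {u. {v, u} \<in> E}"

definition wsum :: "'a set set \<Rightarrow> ('a set \<Rightarrow> int) \<Rightarrow> 'a \<Rightarrow> int" where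
  "wsum E w v = (\<Sum>e\<in>inc E v. w e)"

text \<open>Degrees refer to the edge set being weighted, so after a deletion the edges on which
  sums must differ can only become fewer.\<close>

definition good_weighting :: "'a set set \<Rightarrow> int set \<Rightarrow> ('a set \<Rightarrow> int) \<Rightarrow> bool" where
  "good_weighting E W w \<longleftrightarrow> w ` E \<subseteq> W \<and> inj_on w E \<and>
     (\<forall>u v. {u, v} \<in> E \<longrightarrow> 2 \<le> deg E u \<longrightarrow> 2 \<le> deg E v \<longrightarrow> wsum E w u \<noteq> wsum E w v)"

text \<open>The size of \<open>W\<close> is only bounded below, so a set that is large enough for
  \<open>E\<close> can be handed unchanged to a smaller edge set.\<close>

definition weightable :: "'a set set \<Rightarrow> bool" where
  "weightable E \<longleftrightarrow> (\<forall>W. finite W \<and> (\<forall>x\<in>W. 0 < x) \<and> card E + 6 \<le> card W \<longrightarrow>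
     (\<exists>w. good_weighting E W w))"

lemma uniform2_neq: "uniform2 E \<Longrightarrow> {u, v} \<in> E \<Longrightarrow> u \<noteq> v"
  by (auto simp: uniform2_def)

lemma uniform2_subset: "uniform2 E \<Longrightarrow> F \<subseteq> E \<Longrightarrow> uniform2 F"
  by (auto simp: uniform2_def intro: finite_subset)

lemma finite_inc: "uniform2 E \<Longrightarrow> finite (inc E v)"
  by (auto simp: uniform2_def inc_def)

text \<open>Incident edges behave well under deletion, while the conditions on the sums are counted
  by neighbours; this bijection links the two.\<close>

lemma bij_nbrs_inc:
  assumes "uniform2 E"
  shows "bij_betw (\<lambda>u. {v, u}) (nbrs E v) (inc E v)"
proof -
  have "e \<in> (\<lambda>u. {v, u}) ` nbrs E v" if "e \<in> E" "v \<in> e" for e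
  proof -
    have "card e = 2" using that assms by (auto simp: uniform2_def)
    then obtain a b where "e = {a, b}" by (auto simp: card_2_iff)
    with that show ?thesis by (auto simp: nbrs_def insert_commute)
  qed
  moreover have "inj_on (\<lambda>u. {v, u}) (nbrs E v)"
    by (auto simp: inj_on_def doubleton_eq_iff)
  ultimately show ?thesis
    by (auto simp: bij_betw_def inc_def nbrs_def)
qed

lemma card_nbrs: "uniform2 E \<Longrightarrow> card (nbrs E v) = deg E v"
  using bij_nbrs_inc[of E v] by (simp add: bij_betw_same_card deg_def)

lemma finite_nbrs: "uniform2 E \<Longrightarrow> finite (nbrs E v)"
  using bij_nbrs_inc[of E v] finite_inc bij_betw_finite by metis

lemma nbrs_sym: "u \<in> nbrs E v \<longleftrightarrow> v \<in> nbrs E u"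
  by (simp add: nbrs_def insert_commute)

lemma wsum_nbrs:
  assumes "uniform2 E"
  shows "wsum E w v = (\<Sum>u\<in>nbrs E v. w {v, u})"
  unfolding wsum_def by (rule sum.reindex_bij_betw[OF bij_nbrs_inc[OF assms], symmetric])

lemma deg_pos: "uniform2 E \<Longrightarrow> e \<in> E \<Longrightarrow> v \<in> e \<Longrightarrow> 0 < deg E v"
  unfolding deg_def by (auto simp: card_gt_0_iff finite_inc) (auto simp: inc_def)

lemma sum_deg:
  assumes "uniform2 E"
  shows "(\<Sum>v\<in>\<Union>E. deg E v) = 2 * card E"
proof -
  have fin: "finite (\<Union>E)" "finite E"
    using assms by (auto simp: uniform2_def intro!: finite_Union intro: card_ge_0_finite)
  have "(\<Sum>v\<in>\<Union>E. deg E v) = (\<Sum>v\<in>\<Union>E. \<Sum>e\<in>E. if v \<in> e then 1 else 0)"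
    using fin by (simp add: deg_def inc_def sum.If_cases Int_def)
  also have "\<dots> = (\<Sum>e\<in>E. \<Sum>v\<in>\<Union>E. if v \<in> e then 1 else 0)"
    by (rule sum.swap)
  also have "\<dots> = (\<Sum>e\<in>E. 2)"
  proof (rule sum.cong[OF refl])
    fix e assume e: "e \<in> E"
    then have "\<Union>E \<inter> {v. v \<in> e} = e" by auto
    with e fin assms show "(\<Sum>v\<in>\<Union>E. if v \<in> e then 1 else 0) = (2::nat)"
      by (simp add: sum.If_cases uniform2_def)
  qed
  finally show ?thesis by simp
qed

section \<open>Extending a weighting to deleted edges\<close>

text \<open>An edge that meets no edge of \<open>D\<close> keeps the degrees and sums of both ends,
  so only edges with an end in \<open>\<Union>D\<close> need checking. The separate set
  \<open>W'\<close> makes it possible to withhold weights from the smaller edge set.\<close>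

lemma extend_weighting:
  assumes E: "uniform2 E" and D: "D \<subseteq> E" and good: "good_weighting (E - D) W' w'"
    and W': "W' \<subseteq> W" and inj: "inj_on a D" and a: "a ` D \<subseteq> W - w' ` (E - D)"
    and dist: "\<And>u v. {u, v} \<in> E \<Longrightarrow> u \<noteq> v \<Longrightarrow> u \<in> \<Union>D \<Longrightarrow> 2 \<le> deg E u \<Longrightarrow> 2 \<le> deg E v \<Longrightarrow>
      wsum (E - D) w' u + wsum D a u \<noteq> wsum (E - D) w' v + wsum D a v"
  shows "\<exists>w. good_weighting E W w"
proof -
  define w where "w = (\<lambda>e. if e \<in> D then a e else w' e)"
  have sum_w: "wsum E w v = wsum (E - D) w' v + wsum D a v" for v
  proof -
    have un: "inc E v = inc (E - D) v \<union> inc D v" using D by (auto simp: inc_def)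
    have "wsum E w v = (\<Sum>e\<in>inc (E - D) v. w e) + (\<Sum>e\<in>inc D v. w e)"
      unfolding wsum_def un
      by (rule sum.union_disjoint)
        (use E D in \<open>auto simp: inc_def uniform2_def intro: finite_subset\<close>)
    also have "\<dots> = wsum (E - D) w' v + wsum D a v"
      unfolding wsum_def by (intro arg_cong2[of _ _ _ _ "(+)"] sum.cong) (auto simp: w_def inc_def)
    finally show ?thesis .
  qed
  have "w ` E \<subseteq> W"
    using good a W' by (auto simp: w_def good_weighting_def)
  moreover have "inj_on w E"
    using good a inj unfolding w_def good_weighting_def inj_on_def by (auto simp: image_iff)
  moreover have "wsum E w u \<noteq> wsum E w v"
    if uv: "{u, v} \<in> E" "2 \<le> deg E u" "2 \<le> deg E v" for u v
  proof -
    have "u \<noteq> v" using uniform2_neq[OF E] uv by blast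
    consider "u \<in> \<Union>D" | "v \<in> \<Union>D" | "u \<notin> \<Union>D" "v \<notin> \<Union>D" by blast
    then show ?thesis
    proof cases
      case 1
      then show ?thesis using dist uv \<open>u \<noteq> v\<close> by (simp add: sum_w)
    next
      case 2
      then show ?thesis using dist[of v u] uv \<open>u \<noteq> v\<close> by (simp add: sum_w insert_commute)
    next
      case 3
      then have "inc (E - D) u = inc E u" "inc (E - D) v = inc E v" "inc D u = {}" "inc D v = {}"
        "{u, v} \<in> E - D"
        using uv by (auto simp: inc_def)
      with uv good show ?thesis
        by (simp add: sum_w good_weighting_def deg_def wsum_def[of D])
    qed
  qed
  ultimately show ?thesis unfolding good_weighting_def by blast
qed

lemma card_unused:
  assumes "finite E" "D \<subseteq> E" "finite W" "card E + 6 \<le> card W"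
  shows "card D + 6 \<le> card (W - w ` (E - D))"
proof -
  have "card (w ` (E - D)) \<le> card E - card D"
    using assms by (metis card_Diff_subset card_image_le finite_Diff finite_subset)
  moreover have "card W - card (w ` (E - D)) \<le> card (W - w ` (E - D))"
    using assms by (simp add: diff_card_le_card_Diff)
  moreover have "card D \<le> card E" using assms by (simp add: card_mono)
  ultimately show ?thesis using assms by linarith
qed

lemma obtain_not_in:
  assumes "card F < card A" "finite F"
  obtains x where "x \<in> A" "x \<notin> F"
proof -
  have "\<not> A \<subseteq> F" using assms card_mono leD by blast
  then show ?thesis using that by blast
qed

section \<open>Reducing a pendant edge and a path with two edges\<close>

text \<open>Seven weights are free for the deleted edge. The edge itself imposes no condition, and
  every other edge from \<open>u\<close> to a non-leaf excludes one weight.\<close>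

lemma leaf_reduction:
  assumes E: "uniform2 E" and ul: "{u, l} \<in> E" and l: "deg E l = 1"
    and few: "card {z \<in> nbrs E u. 2 \<le> deg E z} \<le> 6"
    and IH: "weightable (E - {{u, l}})"
  shows "weightable E"
  unfolding weightable_def
proof (intro allI impI)
  fix W :: "int set"
  assume W: "finite W \<and> (\<forall>x\<in>W. 0 < x) \<and> card E + 6 \<le> card W"
  have finE: "finite E" using E by (simp add: uniform2_def)
  have "card (E - {{u, l}}) \<le> card E" using finE by (simp add: card_Diff1_le)
  then obtain w' where w': "good_weighting (E - {{u, l}}) W w'"
    using IH W unfolding weightable_def by (meson add_le_mono1 le_trans)
  define s where "s = wsum (E - {{u, l}}) w'"
  let ?N = "{z \<in> nbrs E u. 2 \<le> deg E z}"
  have finN: "finite ?N" using finite_nbrs[OF E] by simp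
  have "card ((\<lambda>z. s z - s u) ` ?N) \<le> 6"
    using few card_image_le[OF finN] le_trans by blast
  moreover have "7 \<le> card (W - w' ` (E - {{u, l}}))"
    using card_unused[of E "{{u, l}}" W w'] finE ul W by simp
  ultimately have less: "card ((\<lambda>z. s z - s u) ` ?N) < card (W - w' ` (E - {{u, l}}))"
    by linarith
  obtain c where c: "c \<in> W - w' ` (E - {{u, l}})" "c \<notin> (\<lambda>z. s z - s u) ` ?N"
    by (rule obtain_not_in[OF less finite_imageI[OF finN]])
  show "\<exists>w. good_weighting E W w"
  proof (rule extend_weighting[OF E _ w' order_refl, of "\<lambda>_. c"])
    fix p q assume pq: "{p, q} \<in> E" "p \<noteq> q" "p \<in> \<Union>{{u, l}}" "2 \<le> deg E p" "2 \<le> deg E q"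
    then have [simp]: "p = u" and ql: "q \<noteq> l" using l by auto
    have "inc {{u, l}} u = {{u, l}}" "inc {{u, l}} q = {}" using pq ql by (auto simp: inc_def)
    moreover have "q \<in> ?N" using pq by (simp add: nbrs_def)
    then have "c \<noteq> s q - s u" using c(2) by blast
    ultimately show "wsum (E - {{u, l}}) w' p + wsum {{u, l}} (\<lambda>_. c) p \<noteq>
        wsum (E - {{u, l}}) w' q + wsum {{u, l}} (\<lambda>_. c) q"
      by (simp add: wsum_def[of "{{u, l}}"] flip: s_def)
  qed (use ul c in auto)
qed

text \<open>Eight weights are free. They are chosen greedily, first \<open>\<alpha>\<close> for
  \<open>vx\<close> and then \<open>\<beta>\<close> for \<open>vy\<close>, and each choice has at
  most seven forbidden values.\<close>

lemma path_reduction: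
  assumes E: "uniform2 E" and vx: "{v, x} \<in> E" and vy: "{v, y} \<in> E" and xy: "x \<noteq> y"
    and degx: "deg E x \<le> 7" and degy: "deg E y + deg E v \<le> 8"
    and IH: "weightable (E - {{v, x}, {v, y}})"
  shows "weightable E"
  unfolding weightable_def
proof (intro allI impI)
  fix W :: "int set"
  assume W: "finite W \<and> (\<forall>x\<in>W. 0 < x) \<and> card E + 6 \<le> card W"
  let ?D = "{{v, x}, {v, y}}"
  have finE: "finite E" using E by (simp add: uniform2_def)
  have neq: "v \<noteq> x" "v \<noteq> y" using uniform2_neq[OF E] vx vy by blast+
  have cardD: "card ?D = 2" using neq xy by (simp add: doubleton_eq_iff)
  have "card (E - ?D) \<le> card E" using finE by (simp add: card_mono)
  then obtain w' where w': "good_weighting (E - ?D) W w'"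
    using IH W unfolding weightable_def by (meson add_le_mono1 le_trans)
  define s where "s = wsum (E - ?D) w'"
  define A where "A = W - w' ` (E - ?D)"
  have cardA: "8 \<le> card A"
    using card_unused[of E ?D W w'] finE vx vy W cardD by (simp add: A_def)
  note fin = finite_nbrs[OF E]
  have [simp]: "x \<in> nbrs E v" "y \<in> nbrs E v" "v \<in> nbrs E x" "v \<in> nbrs E y"
    using vx vy by (auto simp: nbrs_def insert_commute)

  \<comment> \<open>The value \<open>s y - s v\<close> is excluded on account of the edge
    \<open>vy\<close>: \<open>\<beta>\<close> counts at both of its ends and cancels, so this edge
    depends on \<open>\<alpha>\<close> only.\<close>
  define F1 where "F1 = (\<lambda>z. s z - s x) ` (nbrs E x - {v}) \<union> {s y - s v}"
  have "card ((\<lambda>z. s z - s x) ` (nbrs E x - {v})) \<le> deg E x - 1"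
    using card_image_le[of "nbrs E x - {v}" "\<lambda>z. s z - s x"] fin
    by (simp add: card_nbrs[OF E])
  moreover have "0 < deg E x" using deg_pos[OF E vx] by simp
  ultimately have "card F1 \<le> 7"
    unfolding F1_def using degx
      card_Un_le[of "(\<lambda>z. s z - s x) ` (nbrs E x - {v})" "{s y - s v}"] by simp
  then obtain \<alpha> where \<alpha>: "\<alpha> \<in> A" "\<alpha> \<notin> F1"
    using cardA obtain_not_in[of F1 A] fin by (auto simp: F1_def)

  \<comment> \<open>The conditional covers an edge \<open>xy\<close>, whose end \<open>x\<close> has
    already gained \<open>\<alpha>\<close>.\<close>
  define g where "g = (\<lambda>z. s z + (if z = x then \<alpha> else 0) - s y)"
  define h where "h = (\<lambda>z. s z - s v - \<alpha>)"
  \<comment> \<open>Excluding \<open>\<alpha>\<close> gives injectivity, and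
    \<open>s x - s v\<close> settles \<open>vx\<close>, where \<open>\<alpha>\<close> cancels. With
    the other neighbours of \<open>y\<close> and \<open>v\<close> this makes at most
    \<open>2 + (deg E y - 1) + (deg E v - 2)\<close> values.\<close>
  define F2 where "F2 = {\<alpha>, s x - s v} \<union> (g ` (nbrs E y - {v}) \<union> h ` (nbrs E v - {x, y}))"
  have "card (g ` (nbrs E y - {v})) \<le> deg E y - 1"
    using card_image_le[of "nbrs E y - {v}" g] fin by (simp add: card_nbrs[OF E])
  moreover have "card (h ` (nbrs E v - {x, y})) \<le> deg E v - 2"
    using card_image_le[of "nbrs E v - {x, y}" h] fin xy
    by (simp add: card_nbrs[OF E] card_Diff_subset)
  moreover have "0 < deg E y" using deg_pos[OF E vy] by simp
  moreover have "2 \<le> deg E v"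
    using card_mono[of "nbrs E v" "{x, y}"] fin xy by (simp add: card_nbrs[OF E])
  moreover have "card {\<alpha>, s x - s v} \<le> 2" by (simp add: card_insert_if)
  ultimately have "card F2 \<le> 7"
    unfolding F2_def using degy
      card_Un_le[of "{\<alpha>, s x - s v}" "g ` (nbrs E y - {v}) \<union> h ` (nbrs E v - {x, y})"]
      card_Un_le[of "g ` (nbrs E y - {v})" "h ` (nbrs E v - {x, y})"] by linarith
  then obtain \<beta> where \<beta>: "\<beta> \<in> A" "\<beta> \<notin> F2"
    using cardA obtain_not_in[of F2 A] fin by (auto simp: F2_def)

  define a where "a = (\<lambda>e. if e = {v, x} then \<alpha> else \<beta>)"
  have a_simps: "a {v, x} = \<alpha>" "a {v, y} = \<beta>"
    using neq xy by (auto simp: a_def doubleton_eq_iff)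
  have "inc ?D v = ?D" "inc ?D x = {{v, x}}" "inc ?D y = {{v, y}}"
    using neq xy by (auto simp: inc_def)
  then have sums: "wsum ?D a v = \<alpha> + \<beta>" "wsum ?D a x = \<alpha>" "wsum ?D a y = \<beta>"
    using neq xy by (auto simp: wsum_def a_simps doubleton_eq_iff)
  have sum0: "wsum ?D a z = 0" if "z \<noteq> v" "z \<noteq> x" "z \<noteq> y" for z
  proof -
    have "inc ?D z = {}" using that by (auto simp: inc_def)
    then show ?thesis by (simp add: wsum_def)
  qed
  have vx_ok: "s v + (\<alpha> + \<beta>) \<noteq> s x + \<alpha>" using \<beta>(2) by (auto simp: F2_def)
  have vy_ok: "s v + (\<alpha> + \<beta>) \<noteq> s y + \<beta>" using \<alpha>(2) by (auto simp: F1_def)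
  have x_ok: "s x + \<alpha> \<noteq> s z" if "z \<in> nbrs E x" "z \<noteq> v" for z
  proof
    assume "s x + \<alpha> = s z"
    then have "\<alpha> = s z - s x" by simp
    then show False using \<alpha>(2) that by (auto simp: F1_def)
  qed
  have v_ok: "s v + (\<alpha> + \<beta>) \<noteq> s z" if "z \<in> nbrs E v" "z \<noteq> x" "z \<noteq> y" for z
  proof
    assume "s v + (\<alpha> + \<beta>) = s z"
    then have "\<beta> = h z" by (simp add: h_def)
    then show False using \<beta>(2) that by (auto simp: F2_def)
  qed
  have y_ok: "s y + \<beta> \<noteq> s z + (if z = x then \<alpha> else 0)" if "z \<in> nbrs E y" "z \<noteq> v" for z
  proof
    assume "s y + \<beta> = s z + (if z = x then \<alpha> else 0)"
    then have "\<beta> = g z" by (simp add: g_def)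
    then show False using \<beta>(2) that by (auto simp: F2_def)
  qed
  show "\<exists>w. good_weighting E W w"
  proof (rule extend_weighting[OF E _ w' order_refl, of a])
    show "inj_on a ?D" using \<beta>(2) by (auto simp: inj_on_def a_simps F2_def)
    show "a ` ?D \<subseteq> W - w' ` (E - ?D)" using \<alpha>(1) \<beta>(1) by (auto simp: a_simps A_def)
    fix p q assume pq: "{p, q} \<in> E" "p \<noteq> q" "p \<in> \<Union>?D"
    then have nb: "q \<in> nbrs E p" by (simp add: nbrs_def)
    consider "p = v" | "p = x" | "p = y" using pq by auto
    then have "s p + wsum ?D a p \<noteq> s q + wsum ?D a q"
    proof cases
      case 1
      then show ?thesis using pq vx_ok vy_ok v_ok[of q] nb sums sum0[of q]
        by (cases "q = x"; cases "q = y") auto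
    next
      case 2
      then show ?thesis using pq vx_ok x_ok[of q] y_ok[of x] nb sums sum0[of q] neq xy
        by (cases "q = v"; cases "q = y") (auto simp: nbrs_sym)
    next
      case 3
      then show ?thesis using pq vy_ok y_ok[of q] nb sums sum0[of q] neq xy
        by (cases "q = v"; cases "q = x") auto
    qed
    then show "wsum (E - ?D) w' p + wsum ?D a p \<noteq> wsum (E - ?D) w' q + wsum ?D a q"
      by (simp add: s_def)
  qed (use vx vy in auto)
qed

section \<open>Subset sums and bijections with forbidden values\<close>

text \<open>Induction on \<open>m\<close>: adding the maximum \<open>M\<close> to the
  \<open>m\<close>-subsets of the rest gives \<open>m + j\<close> sums. One more, smaller than all
  of these, arises by adding some \<open>x < M\<close> to an \<open>m\<close>-subset
  \<open>T\<close> of least sum; such an \<open>x\<close> outside \<open>T\<close> exists because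
  \<open>j\<close> is positive.\<close>

lemma card_subset_sums:
  fixes V :: "int set"
  assumes "finite V" "1 \<le> m" "1 \<le> j" "card V = m + j"
  shows "m + j \<le> card (Sum ` {T. T \<subseteq> V \<and> card T = m})"
  using assms(2,1,3,4)
proof (induction m arbitrary: V rule: nat_induct_at_least)
  case base
  have "V \<subseteq> Sum ` {T. T \<subseteq> V \<and> card T = 1}"
  proof
    fix x assume "x \<in> V"
    then show "x \<in> Sum ` {T. T \<subseteq> V \<and> card T = 1}" by (intro image_eqI[of _ _ "{x}"]) auto
  qed
  then show ?case using base card_mono[of "Sum ` {T. T \<subseteq> V \<and> card T = 1}" V] by simp
next
  case (Suc m)
  define M where "M = Max V"
  have "V \<noteq> {}" using Suc.prems by auto
  then have M: "M \<in> V" "\<And>x. x \<in> V \<Longrightarrow> x \<le> M" using Suc.prems by (auto simp: M_def)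
  let ?V = "V - {M}"
  let ?\<S> = "{T. T \<subseteq> ?V \<and> card T = m}"
  have cardV: "card ?V = m + j" using Suc.prems M by simp
  have IH: "m + j \<le> card (Sum ` ?\<S>)" using Suc.IH[of ?V] Suc.prems cardV by simp
  have fin: "finite ?\<S>" using Suc.prems by simp
  have "Sum ` ?\<S> \<noteq> {}"
  proof
    assume "Sum ` ?\<S> = {}"
    then show False using IH Suc.prems(2) unfolding \<open>Sum ` ?\<S> = {}\<close> by simp
  qed
  then have "?\<S> \<noteq> {}" by blast
  define T where "T = arg_min_on Sum ?\<S>"
  have T: "T \<in> ?\<S>" "\<And>T'. T' \<in> ?\<S> \<Longrightarrow> \<Sum>T \<le> \<Sum>T'"
    using arg_min_if_finite(1)[OF fin \<open>?\<S> \<noteq> {}\<close>] arg_min_least[OF fin \<open>?\<S> \<noteq> {}\<close>]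
    unfolding T_def by blast+
  have finT: "finite T" using T Suc.prems finite_subset by auto
  obtain x where x: "x \<in> ?V" "x \<notin> T"
    using obtain_not_in[of T ?V] T cardV Suc.prems finT by auto
  have xM: "x < M" using M x by (simp add: order.strict_iff_order)
  let ?A = "(\<lambda>t. M + t) ` (Sum ` ?\<S>)"
  have "x + \<Sum>T \<notin> ?A"
  proof
    assume "x + \<Sum>T \<in> ?A"
    then obtain T' where "T' \<in> ?\<S>" "x + \<Sum>T = M + \<Sum>T'" by blast
    then show False using T(2)[of T'] xM by linarith
  qed
  then have "Suc m + j \<le> card (insert (x + \<Sum>T) ?A)"
    using IH fin by (simp add: card_image)
  also have "\<dots> \<le> card (Sum ` {T. T \<subseteq> V \<and> card T = Suc m})"
  proof (rule card_mono)
    show "finite (Sum ` {T. T \<subseteq> V \<and> card T = Suc m})" using Suc.prems by simp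
    have "x + \<Sum>T \<in> Sum ` {T. T \<subseteq> V \<and> card T = Suc m}"
      by (rule image_eqI[of _ _ "insert x T"]) (use x T finT in auto)
    moreover have "M + \<Sum>T' \<in> Sum ` {T. T \<subseteq> V \<and> card T = Suc m}" if "T' \<in> ?\<S>" for T'
    proof (rule image_eqI[of _ _ "insert M T'"])
      have "finite T'" "M \<notin> T'" using that Suc.prems finite_subset by auto
      then show "M + \<Sum>T' = \<Sum>(insert M T')" "insert M T' \<in> {T. T \<subseteq> V \<and> card T = Suc m}"
        using that M by auto
    qed
    ultimately show "insert (x + \<Sum>T) ?A \<subseteq> Sum ` {T. T \<subseteq> V \<and> card T = Suc m}" by auto
  qed
  finally show ?case .
qed

lemma obtain_subset_sum_not_in:
  fixes V :: "int set"
  assumes "finite V" "1 \<le> m" "1 \<le> j" "m + j \<le> card V" "finite F" "card F < m + j"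
  obtains T where "T \<subseteq> V" "card T = m" "\<Sum>T \<notin> F"
proof -
  obtain V' where V': "V' \<subseteq> V" "card V' = m + j" "finite V'"
    using obtain_subset_with_card_n assms by metis
  have "m + j \<le> card (Sum ` {T. T \<subseteq> V' \<and> card T = m})"
    using card_subset_sums V' assms by blast
  then obtain t where "t \<in> Sum ` {T. T \<subseteq> V' \<and> card T = m}" "t \<notin> F"
    using obtain_not_in[of F "Sum ` {T. T \<subseteq> V' \<and> card T = m}"] assms by auto
  then show ?thesis using that V' by auto
qed

text \<open>Take a bijection with the fewest violations. If \<open>x\<close> violates, swap its
  value with that of some \<open>y\<close> with \<open>c y \<noteq> f x\<close>: neither
  \<open>x\<close> nor \<open>y\<close> violates afterwards, contradicting minimality.\<close>

lemma bij_avoiding: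
  assumes "finite X" "finite B" "card X = card B"
    and nonconst: "\<And>b. b \<in> B \<Longrightarrow> \<exists>x\<in>X. c x \<noteq> b"
  obtains f where "bij_betw f X B" "\<And>x. x \<in> X \<Longrightarrow> f x \<noteq> c x"
proof -
  let ?viol = "\<lambda>f. {x \<in> X. f x = c x}"
  obtain f0 where "bij_betw f0 X B"
    using assms finite_same_card_bij by blast
  then obtain f where f: "bij_betw f X B"
    and min: "\<And>g. bij_betw g X B \<Longrightarrow> card (?viol f) \<le> card (?viol g)"
    using ex_has_least_nat[of "\<lambda>f. bij_betw f X B" f0 "\<lambda>f. card (?viol f)"] by blast
  have "f x \<noteq> c x" if x: "x \<in> X" for x
  proof
    assume fx: "f x = c x"
    have "f x \<in> B" using f x by (auto simp: bij_betw_def)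
    then obtain y where y: "y \<in> X" "c y \<noteq> f x" using nonconst by blast
    with fx have "x \<noteq> y" by auto
    define g where "g = f(x := f y, y := f x)"
    have "bij_betw g X B"
      using f x y(1) unfolding bij_betw_def inj_on_def g_def by (auto simp: image_iff)
    moreover have "?viol g \<subset> ?viol f"
    proof -
      have "f y \<noteq> f x" using f x y(1) \<open>x \<noteq> y\<close> by (auto simp: bij_betw_def inj_on_def)
      then show ?thesis using x y fx by (auto simp: g_def split: if_splits)
    qed
    then have "card (?viol g) < card (?viol f)"
      using assms(1) by (intro psubset_card_mono) auto
    ultimately show False using min by (simp add: leD)
  qed
  with f show ?thesis using that by blast
qed


lemma largest_subset:
  fixes W :: "int set"
  assumes "finite W" "n \<le> card W"
  obtains R where "R \<subseteq> W" "card R = n" "\<And>r x. r \<in> R \<Longrightarrow> x \<in> W - R \<Longrightarrow> x < r"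
  using assms
proof (induction n arbitrary: thesis)
  case 0
  then show ?case by (metis card.empty empty_iff empty_subsetI)
next
  case (Suc n)
  then obtain R where R: "R \<subseteq> W" "card R = n" "\<And>r x. r \<in> R \<Longrightarrow> x \<in> W - R \<Longrightarrow> x < r"
    by (metis Suc_leD)
  have finR: "finite R" using R(1) Suc.prems(2) finite_subset by blast
  have "W - R \<noteq> {}" using R(2) Suc.prems(3) finR card_mono[of R W] by auto
  define M where "M = Max (W - R)"
  have M: "M \<in> W - R" "\<And>x. x \<in> W - R \<Longrightarrow> x \<le> M"
    using \<open>W - R \<noteq> {}\<close> Suc.prems(2) by (auto simp: M_def simp del: Diff_iff)
  show ?case
  proof (rule Suc.prems(1)[of "insert M R"])
    show "insert M R \<subseteq> W" "card (insert M R) = Suc n" using R M finR by auto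
    show "x < r" if "r \<in> insert M R" "x \<in> W - insert M R" for r x
      using that R(3)[of r x] M(2)[of x] by (cases "r = M") auto
  qed
qed

section \<open>Reducing a star\<close>

text \<open>Here \<open>c x\<close> is the weight ruled out on the edge to \<open>x\<close>,
  \<open>F\<close> holds the totals ruled out at the centre, and \<open>R\<close> the reserved
  weights. Two reserved weights are fixed, a subset sum avoiding \<open>F\<close> supplies the
  others, and \<open>bij_avoiding\<close> places them all.\<close>

lemma star_weights:
  fixes c :: "'a \<Rightarrow> int" and U R F :: "int set"
  assumes X: "finite X" "3 \<le> card X" and U: "finite U" "card X + 6 \<le> card U"
    and R: "R \<subseteq> U" "card R = card X" and F: "finite F"
    and cases: "(\<exists>x\<in>X. c x \<notin> U) \<and> card F \<le> card X + 3 \<or> card F \<le> 3"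
  obtains f r r' where "inj_on f X" "f ` X \<subseteq> U" "(\<Sum>x\<in>X. f x) \<notin> F"
    "\<And>x. x \<in> X \<Longrightarrow> f x \<noteq> c x" "r \<in> R" "r' \<in> R" "r \<noteq> r'" "r \<in> f ` X" "r' \<in> f ` X"
proof -
  \<comment> \<open>A weight forbidden at every \<open>x\<close> could not be placed anywhere. There
    is at most one, namely the common value of \<open>c\<close>.\<close>
  define K where "K = {b \<in> U. \<forall>x\<in>X. c x = b}"
  obtain x0 where x0: "x0 \<in> X" using X by fastforce
  have K1: "K \<subseteq> {c x0}" using x0 by (auto simp: K_def)
  then have finK: "finite K" and cardK: "card K \<le> 1"
    using finite_subset card_mono[of "{c x0}" K] by auto
  \<comment> \<open>The right side is the guaranteed number of sums of \<open>card X - 2\<close>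
    weights from \<open>U - (K \<union> P)\<close>, for the pair \<open>P\<close> chosen below. A
    value of \<open>c\<close> outside \<open>U\<close> makes \<open>K\<close> empty, which yields
    the extra sum needed for the weaker bound on \<open>F\<close>.\<close>
  have cardF: "card F < card X - 2 + (6 - card K)"
  proof (cases "card F \<le> 3")
    case True
    then show ?thesis using cardK X by linarith
  next
    case False
    then obtain x where "x \<in> X" "c x \<notin> U" using cases by blast
    then have "K = {}" unfolding K_def by (metis (mono_tags, lifting) Collect_empty_eq)
    then show ?thesis using False cases X by simp
  qed
  have "card X - card K \<le> card (R - K)"
    using diff_card_le_card_Diff[OF finK, of R] R by simp
  then have "2 \<le> card (R - K)" using X cardK by linarith
  then obtain P where P: "P \<subseteq> R - K" "card P = 2" by (rule obtain_subset_with_card_n)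
  then obtain r r' where r: "P = {r, r'}" "r \<noteq> r'" by (auto simp: card_2_iff)
  have "card U - card (K \<union> P) \<le> card (U - (K \<union> P))"
    using finK r by (intro diff_card_le_card_Diff) simp
  moreover have "card (K \<union> P) \<le> card K + 2" using card_Un_le[of K P] P by simp
  ultimately have "card X - 2 + (6 - card K) \<le> card (U - (K \<union> P))"
    using U X cardK by linarith
  then obtain T where T: "T \<subseteq> U - (K \<union> P)" "card T = card X - 2"
    "\<Sum>T \<notin> (\<lambda>t. t - (r + r')) ` F"
  proof (rule obtain_subset_sum_not_in[rotated 3])
    show "card ((\<lambda>t. t - (r + r')) ` F) < card X - 2 + (6 - card K)"
      using cardF card_image_le[OF F] le_less_trans by blast
  qed (use U X cardK F in auto)
  define B where "B = T \<union> P"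
  have finT: "finite T" using T U finite_subset by blast
  have TP: "T \<inter> P = {}" using T by auto
  have BU: "B \<subseteq> U" "B \<inter> K = {}" using T P R by (auto simp: B_def)
  have "card X = card B"
    using card_Un_disjoint[OF finT _ TP] P T(2) X r by (simp add: B_def)
  moreover have "\<exists>x\<in>X. c x \<noteq> b" if "b \<in> B" for b
    using BU that by (auto simp: K_def)
  moreover have "finite B" using finT r by (simp add: B_def)
  ultimately obtain f where f: "bij_betw f X B" "\<And>x. x \<in> X \<Longrightarrow> f x \<noteq> c x"
    using bij_avoiding[of X B c] X by blast
  have "(\<Sum>x\<in>X. f x) = \<Sum>B" using sum.reindex_bij_betw[OF f(1), of "\<lambda>x. x"] by simp
  also have "\<dots> = \<Sum>T + (r + r')"
    using finT TP r unfolding B_def by (subst sum.union_disjoint) auto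
  finally have "(\<Sum>x\<in>X. f x) \<notin> F" using T(3) by (force simp: image_iff)
  moreover have "r \<in> R" "r' \<in> R" "r \<in> B" "r' \<in> B" using P r by (auto simp: B_def)
  ultimately show ?thesis
    using that[of f r r'] f BU r by (auto simp: bij_betw_def)
qed

text \<open>Edges from \<open>u\<close> into \<open>X\<close> are settled by the reserved weights,
  those from \<open>u\<close> to other vertices by avoiding \<open>F\<close>. Of the remaining edges
  at \<open>X\<close>, those leaving \<open>X\<close> are settled by avoiding \<open>c\<close>,
  those inside \<open>X\<close> by injectivity.\<close>

lemma star_reduction:
  assumes E: "uniform2 E"
    and X_def: "X = {x \<in> nbrs E u. deg E x \<le> 2}" and X3: "3 \<le> card X"
    and few: "card (nbrs E u - X) \<le> card {x \<in> X. deg E x = 1} + 3"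
    and IH: "weightable (E - (\<lambda>x. {u, x}) ` X)"
  shows "weightable E"
  unfolding weightable_def
proof (intro allI impI)
  fix W :: "int set"
  assume W: "finite W \<and> (\<forall>x\<in>W. 0 < x) \<and> card E + 6 \<le> card W"
  define D where "D = (\<lambda>x. {u, x}) ` X"
  define E' where "E' = E - D"
  have finE: "finite E" using E by (simp add: uniform2_def)
  have E'2: "uniform2 E'" using uniform2_subset[OF E] by (auto simp: E'_def)
  have finX: "finite X" using X3 card.infinite by fastforce
  have DE: "D \<subseteq> E" by (auto simp: D_def X_def nbrs_def)
  have uX: "u \<notin> X" using uniform2_neq[OF E, of u u] unfolding X_def nbrs_def by blast
  have cardD: "card D = card X"
    unfolding D_def by (rule card_image) (auto simp: inj_on_def doubleton_eq_iff)
  have cardE': "card E' + card X = card E"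
    using finE DE cardD card_mono[OF finE DE] finite_subset[OF DE finE]
    by (simp add: E'_def card_Diff_subset)
  obtain R where R: "R \<subseteq> W" "card R = card X" "\<And>r x. r \<in> R \<Longrightarrow> x \<in> W - R \<Longrightarrow> x < r"
    using largest_subset[of W "card X"] W cardE' by (metis add.commute le_add1 le_trans)
  have "card E' + 6 \<le> card (W - R)"
    using W R(2) cardE' card_Diff_subset[OF finite_subset[OF R(1)] R(1)] by linarith
  then obtain w' where w': "good_weighting E' (W - R) w'"
    using IH W unfolding weightable_def E'_def D_def by (meson finite_Diff DiffD1)
  then have w'W: "w' e \<in> W - R" if "e \<in> E'" for e using that by (auto simp: good_weighting_def)
  define s where "s = wsum E' w'"
  define U where "U = W - w' ` E'"
  have cardU: "card X + 6 \<le> card U"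
    using card_unused[of E D W w'] finE DE W cardD by (simp add: U_def E'_def)
  have RU: "R \<subseteq> U" using w'W R(1) by (auto simp: U_def)
  have U_pos: "0 < t" if "t \<in> U" for t using that W by (auto simp: U_def)
  define F where "F = (\<lambda>z. s z - s u) ` (nbrs E u - X)"
  have finF: "finite F" using finite_nbrs[OF E] by (simp add: F_def)
  have cardF: "card F \<le> card {x \<in> X. deg E x = 1} + 3"
    using few card_image_le[of "nbrs E u - X"] finite_nbrs[OF E] unfolding F_def
    by (meson finite_Diff le_trans)

  have incX: "inc E x = insert {u, x} (inc E' x)" "{u, x} \<notin> inc E' x" if "x \<in> X" for x
    using that DE uX by (auto simp: inc_def E'_def D_def doubleton_eq_iff)
  have degX: "deg E x = Suc (deg E' x)" if "x \<in> X" for x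
    using incX[OF that] finite_inc[OF E'2] by (simp add: deg_def)
  have only: "inc E' x = {{x, y}}" if "x \<in> X" "{x, y} \<in> E'" for x y
  proof -
    have "deg E' x \<le> 1" using degX that X_def by fastforce
    moreover have "{x, y} \<in> inc E' x" using that by (simp add: inc_def)
    ultimately show ?thesis
      using finite_inc[OF E'2] by (metis One_nat_def card_le_Suc0_iff_eq deg_def subset_singletonD
          subsetI singletonI empty_iff)
  qed

  \<comment> \<open>For a leaf the value 0 serves, since \<open>U\<close> contains only positive
    weights. For a vertex of degree 2 with other neighbour \<open>y\<close>, \<open>c\<close> is the
    weight that would produce a tie if \<open>y\<close> kept its sum.\<close>
  have "\<exists>c. (deg E x = 1 \<longrightarrow> c \<notin> U) \<and> (\<forall>y. {x, y} \<in> E' \<longrightarrow> s x + c = s y)" if x: "x \<in> X" for x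
  proof (cases "\<exists>y. {x, y} \<in> E'")
    case True
    then obtain y where y: "{x, y} \<in> E'" by blast
    have "deg E x \<noteq> 1" using degX[OF x] only[OF x y] by (simp add: deg_def)
    moreover have "y' = y" if "{x, y'} \<in> E'" for y'
      using only[OF x y] only[OF x that] by (auto simp: doubleton_eq_iff)
    ultimately show ?thesis by (intro exI[of _ "s y - s x"]) auto
  next
    case False
    then show ?thesis using U_pos by (intro exI[of _ 0]) auto
  qed
  then obtain c where c: "\<And>x. x \<in> X \<Longrightarrow> deg E x = 1 \<Longrightarrow> c x \<notin> U"
    "\<And>x y. x \<in> X \<Longrightarrow> {x, y} \<in> E' \<Longrightarrow> s x + c x = s y"
    by metis
  \<comment> \<open>A leaf in \<open>X\<close> supplies a value of \<open>c\<close> outside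
    \<open>U\<close>; without leaves the bound on \<open>F\<close> is 3.\<close>
  have "(\<exists>x\<in>X. c x \<notin> U) \<and> card F \<le> card X + 3 \<or> card F \<le> 3"
  proof (cases "{x \<in> X. deg E x = 1} = {}")
    case True
    then show ?thesis using cardF by (metis add_0 card.empty)
  next
    case False
    moreover have "card {x \<in> X. deg E x = 1} \<le> card X" using finX by (simp add: card_mono)
    ultimately show ?thesis using cardF c(1) by fastforce
  qed
  then obtain f r r' where f: "inj_on f X" "f ` X \<subseteq> U" "(\<Sum>x\<in>X. f x) \<notin> F"
    "\<And>x. x \<in> X \<Longrightarrow> f x \<noteq> c x" and r: "r \<in> R" "r' \<in> R" "r \<noteq> r'" "r \<in> f ` X" "r' \<in> f ` X"
    using star_weights[OF finX X3 _ cardU RU R(2) finF, of c] W unfolding U_def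
    by (metis finite_Diff)

  define a where "a = (\<lambda>e. f (the_elem (e - {u})))"
  have a_simp: "a {u, x} = f x" if "x \<in> X" for x
  proof -
    have "{u, x} - {u} = {x}" using that uX by auto
    then show ?thesis by (simp add: a_def)
  qed
  have "inc D u = D" by (auto simp: inc_def D_def)
  then have "wsum D a u = sum a D" by (simp add: wsum_def)
  then have sum_u: "wsum D a u = (\<Sum>x\<in>X. f x)"
    unfolding D_def by (subst (asm) sum.reindex) (auto simp: inj_on_def doubleton_eq_iff a_simp)
  have sum_x: "wsum D a x = f x" if "x \<in> X" for x
  proof -
    have "inc D x = {{u, x}}" using that uX by (auto simp: inc_def D_def)
    then show ?thesis using that by (simp add: wsum_def a_simp)
  qed
  have sum0: "wsum D a z = 0" if "z \<noteq> u" "z \<notin> X" for z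
  proof -
    have "inc D z = {}" using that by (auto simp: inc_def D_def)
    then show ?thesis by (simp add: wsum_def)
  qed
  have s_nonneg: "0 \<le> s u"
    unfolding s_def wsum_def using w'W W by (intro sum_nonneg) (force simp: inc_def)
  \<comment> \<open>One of the two reserved weights at \<open>u\<close> is not on the edge \<open>ux\<close>; it exceeds the only
    other weight at \<open>x\<close>.\<close>
  have u_gt_x: "s x + f x < s u + (\<Sum>x\<in>X. f x)" if x: "x \<in> X" "{x, y} \<in> E'" for x y
  proof -
    obtain x' where x': "x' \<in> X" "x' \<noteq> x" "f x' \<in> R" using r by blast
    have "s x = w' {x, y}" using only[OF x] by (simp add: s_def wsum_def)
    also have "\<dots> < f x'" using R(3)[OF x'(3)] w'W x by blast
    also have "f x' \<le> (\<Sum>z\<in>X - {x}. f z)"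
      using x' finX f(2) U_pos by (intro member_le_sum) (auto intro: less_imp_le)
    finally show ?thesis using sum.remove[OF finX x(1), of f] s_nonneg by simp
  qed

  have u_ok: "s u + (\<Sum>x\<in>X. f x) \<noteq> s q + wsum D a q"
    if q: "{u, q} \<in> E" "2 \<le> deg E q" for q
  proof (cases "q \<in> X")
    case True
    then have "inc E' q \<noteq> {}" using degX[OF True] q by (auto simp: deg_def)
    then obtain y where "{q, y} \<in> E'"
      using bij_nbrs_inc[OF E'2, of q] by (auto simp: bij_betw_def nbrs_def)
    then show ?thesis using u_gt_x[OF True] True by (fastforce simp: sum_x)
  next
    case False
    then have "q \<in> nbrs E u - X" "q \<noteq> u" using q uniform2_neq[OF E] by (auto simp: nbrs_def)
    then have "(\<Sum>x\<in>X. f x) \<noteq> s q - s u" "wsum D a q = 0"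
      using f(3) False by (auto simp: F_def sum0)
    then show ?thesis by simp
  qed
  show "\<exists>w. good_weighting E W w"
  proof (rule extend_weighting[OF E DE w'[unfolded E'_def], of W a])
    show "W - R \<subseteq> W" by blast
    show "inj_on a D" using f(1) by (auto simp: D_def inj_on_def a_simp)
    show "a ` D \<subseteq> W - w' ` (E - D)"
      using f(2) by (auto simp: D_def a_simp U_def E'_def)
    fix p q assume pq: "{p, q} \<in> E" "p \<noteq> q" "p \<in> \<Union>D" "2 \<le> deg E p" "2 \<le> deg E q"
    have "s p + wsum D a p \<noteq> s q + wsum D a q"
    proof (cases "p = u \<or> q = u")
      case True
      then show ?thesis
        using u_ok[of q] u_ok[of p] pq by (auto simp: sum_u insert_commute)
    next
      case False
      have pX: "p \<in> X" using pq(3) False unfolding D_def by blast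
      have "u \<in> e" if "e \<in> D" for e using that by (auto simp: D_def)
      then have "{p, q} \<notin> D" using False by blast
      then have pE': "{p, q} \<in> E'" using pq(1) by (simp add: E'_def)
      show ?thesis
      proof (cases "q \<in> X")
        case True
        \<comment> \<open>The edge \<open>pq\<close> is the only one left at either end, so the old
          sums agree and the distinct new weights decide.\<close>
        have "{q, p} \<in> E'" using pE' by (simp add: insert_commute)
        then have "inc E' q = inc E' p"
          using only[OF pX pE'] only[OF True, of p] by (simp add: insert_commute)
        then have "s p = s q" by (simp add: s_def wsum_def)
        moreover have "f p \<noteq> f q" using f(1) pX True pq(2) by (auto simp: inj_on_def)
        ultimately show ?thesis using pX True by (simp add: sum_x)
      next
        case q: False
        then show ?thesis
          using c(2)[OF pX pE'] f(4)[OF pX] False pX by (simp add: sum_x sum0)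
      qed
    qed
    then show "wsum (E - D) w' p + wsum D a p \<noteq> wsum (E - D) w' q + wsum D a q"
      by (simp add: s_def E'_def)
  qed
qed

section \<open>Discharging\<close>

lemma sparse_not_irreducible:
  assumes E: "uniform2 E" and ne: "E \<noteq> {}" and sparse: "2 * card E \<le> 3 * card (\<Union>E)"
    and no_leaf: "\<And>u l. {u, l} \<in> E \<Longrightarrow> deg E l = 1 \<Longrightarrow>
      6 < card {z \<in> nbrs E u. 2 \<le> deg E z}"
    and no_path: "\<And>v x y. {v, x} \<in> E \<Longrightarrow> {v, y} \<in> E \<Longrightarrow> x \<noteq> y \<Longrightarrow> deg E x \<le> 7 \<Longrightarrow>
      8 < deg E y + deg E v"
    and no_star: "\<And>u X. X = {x \<in> nbrs E u. deg E x \<le> 2} \<Longrightarrow> 3 \<le> card X \<Longrightarrow>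
      card {x \<in> X. deg E x = 1} + 3 < card (nbrs E u - X)"
  shows False
proof -
  define V where "V = \<Union>E"
  have finV: "finite V"
    using E by (auto simp: V_def uniform2_def intro!: finite_Union intro: card_ge_0_finite)
  note fin = finite_nbrs[OF E]
  have nbrsV: "u \<in> V" "v \<in> V" if "u \<in> nbrs E v" for u v
    using that by (auto simp: V_def nbrs_def)
  have pos: "0 < deg E v" if "v \<in> V" for v
    using that deg_pos[OF E] by (auto simp: V_def)
  \<comment> \<open>For a leaf this comes from \<open>no_leaf\<close>. At a vertex of degree 2,
    either one neighbour has degree at least 8, or \<open>no_path\<close> forces degree at least 7
    on the other.\<close>
  have big_nbr: "\<exists>u\<in>nbrs E v. 7 \<le> deg E u" if v: "v \<in> V" "deg E v \<le> 2" for v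
  proof -
    consider "deg E v = 1" | "deg E v = 2" using v pos[of v] by linarith
    then show ?thesis
    proof cases
      case 1
      then obtain u where u: "u \<in> nbrs E v"
        using card_nbrs[OF E, of v] by (metis card_1_singletonE singletonI)
      then have "6 < card {z \<in> nbrs E u. 2 \<le> deg E z}"
        using no_leaf[of u v] 1 by (simp add: nbrs_def insert_commute)
      also have "\<dots> \<le> deg E u"
        using card_mono[of "nbrs E u"] fin card_nbrs[OF E, of u] by fastforce
      finally have "7 \<le> deg E u" by simp
      then show ?thesis using u by blast
    next
      case 2
      then obtain x y where xy: "nbrs E v = {x, y}" "x \<noteq> y"
        using card_nbrs[OF E, of v] by (auto simp: card_2_iff)
      then have "{v, x} \<in> E" "{v, y} \<in> E" by (auto simp: nbrs_def)
      then show ?thesis using no_path[of v x y] xy 2 by force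
    qed
  qed
  have big: "card {x \<in> nbrs E u. deg E x = 1} + 4 \<le>
      card (nbrs E u - {x \<in> nbrs E u. deg E x \<le> 2})" if u: "7 \<le> deg E u" for u
  proof (rule ccontr)
    let ?X = "{x \<in> nbrs E u. deg E x \<le> 2}" and ?L = "{x \<in> nbrs E u. deg E x = 1}"
    assume *: "\<not> card ?L + 4 \<le> card (nbrs E u - ?X)"
    have L: "{x \<in> ?X. deg E x = 1} = ?L" by auto
    have split: "card ?X + card (nbrs E u - ?X) = deg E u"
      using card_Int_Diff[of "nbrs E u" ?X] fin card_nbrs[OF E, of u] by (simp add: Int_def)
    have LX: "card ?L \<le> card ?X" using fin by (intro card_mono) auto
    \<comment> \<open>Now \<open>no_star\<close> leaves at most two vertices in \<open>?X\<close>.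
      Degree at least 7 then requires two leaves and degree exactly 7, hence at most five non-leaf
      neighbours, against \<open>no_leaf\<close>.\<close>
    have "card ?X < 3" using no_star[of ?X u] * unfolding L by force
    then have "2 \<le> card ?L" "deg E u \<le> 7" using * split LX u by linarith+
    then obtain l where l: "l \<in> ?L" by (metis card.empty ex_in_conv not_numeral_le_zero)
    then have "6 < card {z \<in> nbrs E u. 2 \<le> deg E z}"
      using no_leaf[of u l] by (simp add: nbrs_def)
    also have "\<dots> \<le> card (nbrs E u - ?L)" using fin by (intro card_mono) auto
    also have "\<dots> = deg E u - card ?L"
      using fin card_nbrs[OF E, of u] by (subst card_Diff_subset) auto
    finally show False using \<open>2 \<le> card ?L\<close> \<open>deg E u \<le> 7\<close> by linarith
  qed

  \<comment> \<open>\<open>g u x\<close> is the charge sent from \<open>u\<close> to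
    \<open>x\<close>, and \<open>ch\<close> is the charge after all transfers, which cancel in the
    total.\<close>
  define g :: "'a \<Rightarrow> 'a \<Rightarrow> int" where
    "g u x = (if x \<in> nbrs E u \<and> 7 \<le> deg E u \<and> deg E x \<le> 2 then 3 - int (deg E x) else 0)" for u x
  define ch where "ch v = int (deg E v) - 3 - (\<Sum>x\<in>V. g v x) + (\<Sum>u\<in>V. g u v)" for v
  have g_nonneg: "0 \<le> g u x" for u x by (simp add: g_def)
  have in_nonneg: "0 \<le> (\<Sum>u\<in>V. g u v)" for v by (simp add: sum_nonneg g_nonneg)
  have "(\<Sum>v\<in>V. ch v) = (\<Sum>v\<in>V. int (deg E v)) - 3 * int (card V)"
    using sum.swap[of g V V] by (simp add: ch_def sum.distrib sum_subtractf)
  also have "(\<Sum>v\<in>V. int (deg E v)) = 2 * int (card E)"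
    using sum_deg[OF E] unfolding V_def by (metis of_nat_mult of_nat_numeral of_nat_sum)
  finally have total: "(\<Sum>v\<in>V. ch v) \<le> 0" using sparse by (simp add: V_def)
  have ch_big: "0 < ch v" if "4 \<le> deg E v" for v
  proof (cases "7 \<le> deg E v")
    case False
    then have "(\<Sum>x\<in>V. g v x) = 0" by (simp add: g_def)
    then show ?thesis using that in_nonneg[of v] by (simp add: ch_def)
  next
    case True
    let ?X = "{x \<in> nbrs E v. deg E x \<le> 2}"
    have "(\<Sum>x\<in>V. g v x) = (\<Sum>x\<in>?X. g v x)"
      by (rule sum.mono_neutral_right) (use finV nbrsV in \<open>auto simp: g_def\<close>)
    \<comment> \<open>A leaf takes 2 and a neighbour of degree 2 takes 1, so by \<open>big\<close>
      at least 1 remains of \<open>deg E v - 3\<close>.\<close>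
    also have "\<dots> = (\<Sum>x\<in>?X. 1 + (if deg E x = 1 then 1 else 0))"
    proof (rule sum.cong[OF refl])
      fix x assume x: "x \<in> ?X"
      then have "0 < deg E x" using pos nbrsV by blast
      with x True show "g v x = 1 + (if deg E x = 1 then 1 else 0)" by (auto simp: g_def)
    qed
    also have "\<dots> = int (card ?X) + int (card {x \<in> ?X. deg E x = 1})"
      using fin by (simp add: sum.distrib sum.If_cases Int_def)
    also have "{x \<in> ?X. deg E x = 1} = {x \<in> nbrs E v. deg E x = 1}" by auto
    finally show ?thesis
      using big[OF True] in_nonneg[of v] card_Int_Diff[of "nbrs E v" ?X] fin card_nbrs[OF E, of v]
      by (simp add: ch_def Int_def)
  qed
  have ch_nonneg: "0 \<le> ch v" if v: "v \<in> V" for v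
  proof (cases "deg E v \<le> 2")
    case True
    then obtain u where u: "u \<in> nbrs E v" "7 \<le> deg E u" using big_nbr v by blast
    then have "g u v = 3 - int (deg E v)" using True by (auto simp: g_def nbrs_sym)
    moreover have "g u v \<le> (\<Sum>u\<in>V. g u v)"
      using nbrsV[OF u(1)] finV g_nonneg by (intro member_le_sum) auto
    moreover have "(\<Sum>x\<in>V. g v x) = 0" using True by (simp add: g_def)
    ultimately show ?thesis by (simp add: ch_def)
  next
    case False
    show ?thesis
    proof (cases "deg E v = 3")
      case True
      then have "(\<Sum>x\<in>V. g v x) = 0" by (simp add: g_def)
      then show ?thesis using True in_nonneg[of v] by (simp add: ch_def)
    next
      case neq: False
      then show ?thesis using ch_big[of v] False by simp
    qed
  qed
  \<comment> \<open>All charges therefore vanish. This rules out degrees of at least 4, and then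
    degrees of at most 2, which would need a neighbour of degree at least 7.\<close>
  have "(\<Sum>v\<in>V. ch v) = 0" using total ch_nonneg by (simp add: sum_nonneg order_antisym)
  then have "ch v = 0" if "v \<in> V" for v
    using sum_nonneg_eq_0_iff[of V ch] finV ch_nonneg that by blast
  then have small: "deg E v < 4" if "v \<in> V" for v
    using ch_big[of v] that by (metis less_irrefl not_less)
  have cubic: "deg E v = 3" if v: "v \<in> V" for v
  proof -
    have "\<not> deg E v \<le> 2"
    proof
      assume "deg E v \<le> 2"
      then obtain u where "u \<in> nbrs E v" "7 \<le> deg E u" using big_nbr v by blast
      then show False using small[of u] nbrsV by fastforce
    qed
    then show ?thesis using small[OF v] by linarith
  qed
  obtain e where e: "e \<in> E" using ne by blast
  then have "e \<noteq> {}" using E by (auto simp: uniform2_def)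
  then obtain v where v: "v \<in> V" using e by (auto simp: V_def)
  have "card (nbrs E v) = 3" using cubic[OF v] card_nbrs[OF E] by simp
  then obtain x y z where "nbrs E v = {x, y, z}" "x \<noteq> y" by (auto simp: card_3_iff)
  then have "x \<in> nbrs E v" "y \<in> nbrs E v" by auto
  then show False
    using no_path[of v x y] cubic v nbrsV \<open>x \<noteq> y\<close> by (fastforce simp: nbrs_def)
qed

section \<open>Induction on the edge set\<close>

text \<open>Sparsity is required of all subsets so that it survives deletions; a minimal
  counterexample then contains none of the reducible configurations.\<close>

lemma sparse_weightable:
  assumes "uniform2 E" "\<And>F. F \<subseteq> E \<Longrightarrow> 2 * card F \<le> 3 * card (\<Union>F)"
  shows "weightable E"
proof -
  have "finite E" using assms by (simp add: uniform2_def)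
  then show ?thesis using assms
  proof (induction E rule: finite_psubset_induct)
    case (psubset E)
    note E = \<open>uniform2 E\<close>
    have IH: "weightable (E - D)" if "D \<subseteq> E" "D \<noteq> {}" for D
    proof (rule psubset.IH)
      show "E - D \<subset> E" using that by blast
      show "uniform2 (E - D)" using uniform2_subset[OF E] by blast
      show "2 * card F \<le> 3 * card (\<Union>F)" if "F \<subseteq> E - D" for F
        using psubset.prems(2) that by blast
    qed
    show ?case
    proof (cases "E = {}")
      case True
      then show ?thesis by (simp add: weightable_def good_weighting_def)
    next
      case False
      show ?thesis
      proof (rule ccontr)
        assume nw: "\<not> weightable E"
        show False
        proof (rule sparse_not_irreducible[OF E False])
          show "2 * card E \<le> 3 * card (\<Union>E)" using psubset.prems(2) by blast
        next
          fix u l assume "{u, l} \<in> E" "deg E l = 1"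
          then show "6 < card {z \<in> nbrs E u. 2 \<le> deg E z}"
            using leaf_reduction[OF E] IH[of "{{u, l}}"] nw by (auto simp: not_le[symmetric])
        next
          fix v x y assume "{v, x} \<in> E" "{v, y} \<in> E" "x \<noteq> y" "deg E x \<le> 7"
          then show "8 < deg E y + deg E v"
            using path_reduction[OF E] IH[of "{{v, x}, {v, y}}"] nw by (auto simp: not_le[symmetric])
        next
          fix u X assume X: "X = {x \<in> nbrs E u. deg E x \<le> 2}" "3 \<le> card X"
          have "(\<lambda>x. {u, x}) ` X \<subseteq> E" using X(1) by (auto simp: nbrs_def)
          moreover have "X \<noteq> {}" using X(2) by (metis card.empty not_numeral_le_zero)
          ultimately show "card {x \<in> X. deg E x = 1} + 3 < card (nbrs E u - X)"
            using star_reduction[OF E X] IH[of "(\<lambda>x. {u, x}) ` X"] nw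
            by (meson image_is_empty not_le)
        qed
      qed
    qed
  qed
qed

section \<open>Returning from edge sets to graphs\<close>

lemma simple_graph_uniform2:
  assumes "simple_graph G"
  shows "uniform2 (edges G)"
proof -
  have "edges G \<subseteq> Pow (verts G)" using assms by (auto simp: simple_graph_def)
  then show ?thesis
    using assms by (auto simp: simple_graph_def uniform2_def intro: finite_subset)
qed

text \<open>For non-empty \<open>F\<close>, the pair \<open>(\<Union>F, F)\<close> is a non-empty
  subgraph, so its ratio is among the finitely many whose maximum is \<open>mad G\<close>.\<close>

lemma mad_le_imp_sparse:
  assumes G: "simple_graph G" and mad: "mad G \<le> 3" and F: "F \<subseteq> edges G"
  shows "2 * card F \<le> 3 * card (\<Union>F)"
proof (cases "F = {}")
  case False
  have FV: "\<Union>F \<subseteq> verts G" using G F by (auto simp: simple_graph_def)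
  then have fin: "finite (\<Union>F)" using G finite_subset by (auto simp: simple_graph_def)
  have ne: "\<Union>F \<noteq> {}"
    using False F G by (fastforce simp: simple_graph_def)
  let ?S = "{2 * real (card (edges H)) / real (card (verts H)) | H. subgraph H G \<and> verts H \<noteq> {}}"
  have "?S \<subseteq> (\<lambda>H. 2 * real (card (edges H)) / real (card (verts H))) ` {H. subgraph H G}"
    by blast
  then have "finite ?S" using finite_subgraphs[OF G] finite_surj by blast
  moreover have "subgraph (\<Union>F, F) G"
    using G F FV fin by (auto simp: subgraph_def simple_graph_def)
  then have "2 * real (card F) / real (card (\<Union>F)) \<in> ?S" using ne by force
  ultimately have "2 * real (card F) / real (card (\<Union>F)) \<le> 3"
    using mad unfolding mad_def by (meson Max_ge order_trans)
  moreover have "0 < card (\<Union>F)" using fin ne by (simp add: card_gt_0_iff)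
  ultimately have "real (2 * card F) \<le> real (3 * card (\<Union>F))"
    by (simp add: divide_simps split: if_splits)
  then show ?thesis by (simp only: of_nat_le_iff)
qed simp

text \<open>If both ends were leaves, nothing but \<open>u\<close> and \<open>v\<close> would be
  reachable from \<open>u\<close>, so their component would be a \<open>K_2\<close>.\<close>

lemma nice_deg_ge_2:
  assumes G: "simple_graph G" and nice: "nice G" and uv: "{u, v} \<in> edges G"
    and u1: "deg (edges G) u = 1"
  shows "2 \<le> deg (edges G) v"
proof (rule ccontr)
  assume *: "\<not> 2 \<le> deg (edges G) v"
  note E = simple_graph_uniform2[OF G]
  have neq: "u \<noteq> v" using uniform2_neq[OF E uv] .
  have v1: "deg (edges G) v = 1" using * deg_pos[OF E uv, of v] by simp
  have "v \<in> nbrs (edges G) u" "u \<in> nbrs (edges G) v"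
    using uv by (auto simp: nbrs_def insert_commute)
  then have nu: "nbrs (edges G) u = {v}" and nv: "nbrs (edges G) v = {u}"
    using u1 v1 card_nbrs[OF E] by (metis card_1_singletonE singletonD)+
  have "x \<in> {u, v}" if "(adj G)\<^sup>*\<^sup>* u x" for x
    using that
  proof (induction rule: rtranclp_induct)
    case (step y z)
    then have "z \<in> nbrs (edges G) y" by (simp add: adj_def nbrs_def)
    then show ?case using step.IH nu nv by auto
  qed simp
  moreover have "adj G u v" using uv by (simp add: adj_def)
  ultimately have reach: "{x. (adj G)\<^sup>*\<^sup>* u x} = {u, v}" by blast
  define C where "C = induced_subgraph G {u, v}"
  have "u \<in> verts G" using G uv by (auto simp: simple_graph_def)
  then have "C \<in> components G" unfolding components_def C_def reach[symmetric] by blast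
  moreover have "isomorphic C (complete_graph 2)"
    unfolding isomorphic_def
  proof (intro exI conjI ballI)
    let ?f = "\<lambda>x. if x = u then 0 else (1::nat)"
    show "bij_betw ?f (verts C) (verts (complete_graph 2))"
      using neq by (auto simp: bij_betw_def C_def induced_subgraph_def complete_graph_def inj_on_def)
    fix x y assume "x \<in> verts C" "y \<in> verts C"
    moreover have "{u} \<notin> edges G" "{v} \<notin> edges G" using E by (auto simp: uniform2_def)
    ultimately show "adj C x y \<longleftrightarrow> adj (complete_graph 2) (?f x) (?f y)"
      using neq uv by (auto simp: C_def induced_subgraph_def complete_graph_def adj_def insert_commute)
  qed
  ultimately show False using nice by (auto simp: nice_def)
qed

lemma good_weighting_distinguishing:
  assumes G: "simple_graph G" and nice: "nice G" and w: "good_weighting (edges G) W w"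
    and W: "\<forall>x\<in>W. 0 < x"
  shows "neighbour_sum_distinguishing G w"
proof -
  note E = simple_graph_uniform2[OF G]
  have sum: "weight_sum G w v = wsum (edges G) w v" for v
    unfolding wsum_nbrs[OF E] weight_sum_def neighbours_def nbrs_def adj_def ..
  \<comment> \<open>At a leaf the sum is the weight of its edge, one of several positive summands at the other end.\<close>
  have leaf: "wsum (edges G) w u < wsum (edges G) w v"
    if uv: "{u, v} \<in> edges G" and u: "deg (edges G) u = 1" for u v
  proof -
    have inu: "inc (edges G) u = {{u, v}}"
    proof -
      have "{u, v} \<in> inc (edges G) u" using uv by (simp add: inc_def)
      then show ?thesis using u unfolding deg_def by (metis card_1_singletonE singletonD)
    qed
    have "inc (edges G) v \<noteq> {{u, v}}"
      using nice_deg_ge_2[OF G nice uv u] by (auto simp: deg_def)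
    moreover have "{u, v} \<in> inc (edges G) v" using uv by (simp add: inc_def)
    ultimately obtain e where e: "e \<in> inc (edges G) v - {{u, v}}" by blast
    have pos: "0 < w e" if "e \<in> inc (edges G) v" for e
      using that w W by (auto simp: inc_def good_weighting_def)
    have "0 < (\<Sum>e\<in>inc (edges G) v - {{u, v}}. w e)"
      using e pos finite_inc[OF E] by (intro sum_pos) auto
    then show ?thesis
      using sum.remove[OF finite_inc[OF E] \<open>{u, v} \<in> inc (edges G) v\<close>, of w] inu
      by (simp add: wsum_def)
  qed
  show ?thesis
    unfolding neighbour_sum_distinguishing_def sum
  proof (intro allI impI)
    fix u v assume "adj G u v"
    then have uv: "{u, v} \<in> edges G" "{v, u} \<in> edges G" by (auto simp: adj_def insert_commute)
    then have "0 < deg (edges G) u" "0 < deg (edges G) v" using deg_pos[OF E] by blast+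
    then consider "deg (edges G) u = 1" | "deg (edges G) v = 1"
      | "2 \<le> deg (edges G) u" "2 \<le> deg (edges G) v" by linarith
    then show "wsum (edges G) w u \<noteq> wsum (edges G) w v"
      using leaf[OF uv(1)] leaf[OF uv(2)] w uv by cases (auto simp: good_weighting_def)
  qed
qed

theorem theorem5p5:
  fixes G :: "'a sgraph"
  assumes "simple_graph G" and "nice G" and "mad G \<le> 3"
  shows "(\<forall>W :: int set. card W = card (edges G) + 6 \<and> (\<forall>x\<in>W. 0 < x) \<longrightarrow>
            (\<exists>w. edge_weighting W G w \<and> edge_injective G w \<and> neighbour_sum_distinguishing G w))
         \<and> chi_e1_sum G \<le> card (edges G) + 6"
proof -
  have weightable: "weightable (edges G)"
    using sparse_weightable simple_graph_uniform2 mad_le_imp_sparse assms by blast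
  have main: "\<exists>w. edge_weighting W G w \<and> edge_injective G w \<and> neighbour_sum_distinguishing G w"
    if W: "card W = card (edges G) + 6" "\<forall>x\<in>W. 0 < x" for W :: "int set"
  proof -
    have "finite W" using W(1) card.infinite by fastforce
    then obtain w where "good_weighting (edges G) W w"
      using weightable W unfolding weightable_def by (metis order_refl)
    then show ?thesis
      using good_weighting_distinguishing[OF assms(1,2) _ W(2), of w]
      by (auto simp: good_weighting_def edge_weighting_def edge_injective_def)
  qed
  \<comment> \<open>The interval from 1 to \<open>card (edges G) + 6\<close> is one of the
    admissible sets \<open>W\<close>.\<close>
  moreover have "chi_e1_sum G \<le> card (edges G) + 6"
    unfolding chi_e1_sum_def by (rule Least_le, rule main) auto
  ultimately show ?thesis by blast
qed

end
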